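(* Let $R$ be a Noetherian commutative ring of prime characteristic $p>0$, let $I$ be a non-zero proper ideal of $R$, and let $\mathfrak{a}_\bullet$ and $\mathfrak{b}_\bullet$ be two filtrations of ideals in $R$. Let $\mathfrak{c}_\bullet=\{\mathfrak{a}_n\mathfrak{b}_n\}_{n\ge 0}$, $\mathfrak{d}_\bullet=\{\mathfrak{a}_n\cap\mathfrak{b}_n\}_{n\ge 0}$ and $\mathfrak{e}_\bullet=\{\sum_{i=0}^n\mathfrak{a}_i\mathfrak{b}_{n-i}\}_{n\ge 0}$ (these are filtrations). Then, for each choice of sign $\pm$ (the same sign throughout), $$\mathcal{C}_{\pm}^I(\mathfrak{c}_\bullet)\le\mathcal{C}_{\pm}^I(\mathfrak{d}_\bullet)\le\mathcal{C}_{\pm}^I(\mathfrak{a}_\bullet)\le\mathcal{C}_{\pm}^I(\mathfrak{e}_\bullet)\quad\text{and}\quad \mathcal{C}_{\pm}^I(\mathfrak{d}_\bullet)\le\mathcal{C}_{\pm}^I(\mathfrak{b}_\bullet)\le\mathcal{C}_{\pm}^I(\mathfrak{e}_\bullet),$$ and $\mathcal{C}_{+}^I(\mathfrak{e}_\bullet)\le\mathcal{C}_{+}^I(\mathfrak{a}_\bullet)+\mathcal{C}_{+}^I(\mathfrak{b}_\bullet)$.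
   Context: A filtration of ideals in $R$ is a sequence $\mathfrak{a}_\bullet=\{\mathfrak{a}_i\}_{i\ge 0}$ of ideals with $\mathfrak{a}_0=R$, $\mathfrak{a}_{i+1}\subseteq\mathfrak{a}_i$, and $\mathfrak{a}_i\mathfrak{a}_j\subseteq \mathfrak{a}_{i+j}$ for all $i,j\ge 0$. $I^{[p^e]}$ is the ideal generated by all $f^{p^e}$, $f\in I$. For $e\ge 0$ put $\nu_{\mathfrak{a}_\bullet}^I(p^e)=\sup\{r\in\mathbb{Z}_{\ge 0}:\mathfrak{a}_r\not\subseteq I^{[p^e]}\}\in\mathbb{Z}_{\ge 0}\cup\{\infty\}$, $\mathcal{C}_+^I(\mathfrak{a}_\bullet)=\limsup_{e\to\infty}\nu_{\mathfrak{a}_\bullet}^I(p^e)/p^e$ and $\mathcal{C}_-^I(\mathfrak{a}_\bullet)=\liminf_{e\to\infty}\nu_{\mathfrak{a}_\bullet}^I(p^e)/p^e$, in $[0,\infty]$. *)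

theory Defs
  imports
    "HOL-Algebra.Ideal_Product"
    "HOL-Algebra.Ring_Divisibility"
    "HOL-Computational_Algebra.Primes"
    "HOL-Library.Extended_Nonnegative_Real"
begin

(* Carrier-based analogue of CHAR('a): the nonnegative generator of the kernel of the
   canonical map from the integers to R. *)
definition ring_char :: "('a, 'b) ring_scheme \<Rightarrow> nat" where
  "ring_char R = Gcd {n :: nat. [n] \<cdot>\<^bsub>R\<^esub> \<one>\<^bsub>R\<^esub> = \<zero>\<^bsub>R\<^esub>}"

definition ideal_filtration :: "('a, 'b) ring_scheme \<Rightarrow> (nat \<Rightarrow> 'a set) \<Rightarrow> bool" where
  "ideal_filtration R \<aa> \<longleftrightarrow>
     (\<forall>i. ideal (\<aa> i) R) \<and>
     \<aa> 0 = carrier R \<and>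
     (\<forall>i. \<aa> (Suc i) \<subseteq> \<aa> i) \<and>
     (\<forall>i j. ideal_prod R (\<aa> i) (\<aa> j) \<subseteq> \<aa> (i + j))"

definition filtration_prod ::
    "('a, 'b) ring_scheme \<Rightarrow> (nat \<Rightarrow> 'a set) \<Rightarrow> (nat \<Rightarrow> 'a set) \<Rightarrow> nat \<Rightarrow> 'a set" where
  "filtration_prod R \<aa> \<bb> = (\<lambda>n. ideal_prod R (\<aa> n) (\<bb> n))"

definition filtration_inter ::
    "(nat \<Rightarrow> 'a set) \<Rightarrow> (nat \<Rightarrow> 'a set) \<Rightarrow> nat \<Rightarrow> 'a set" where
  "filtration_inter \<aa> \<bb> = (\<lambda>n. \<aa> n \<inter> \<bb> n)"

(* The addition of ideals_set R is the sum of ideals, so its finsum is the finite sum of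
   ideals. *)
definition filtration_sum ::
    "('a, 'b) ring_scheme \<Rightarrow> (nat \<Rightarrow> 'a set) \<Rightarrow> (nat \<Rightarrow> 'a set) \<Rightarrow> nat \<Rightarrow> 'a set" where
  "filtration_sum R \<aa> \<bb> =
     (\<lambda>n. finsum (ideals_set R) (\<lambda>i. ideal_prod R (\<aa> i) (\<bb> (n - i))) {0..n})"

(* Applied below with q = p ^ e only. *)
definition frobenius_power :: "('a, 'b) ring_scheme \<Rightarrow> 'a set \<Rightarrow> nat \<Rightarrow> 'a set" where
  "frobenius_power R I q = Idl\<^bsub>R\<^esub> {f [^]\<^bsub>R\<^esub> q | f. f \<in> I}"

definition nu_filtration ::
    "('a, 'b) ring_scheme \<Rightarrow> 'a set \<Rightarrow> (nat \<Rightarrow> 'a set) \<Rightarrow> nat \<Rightarrow> enat" where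
  "nu_filtration R I \<aa> q = Sup {enat r | r. \<not> \<aa> r \<subseteq> frobenius_power R I q}"

definition C_plus ::
    "('a, 'b) ring_scheme \<Rightarrow> nat \<Rightarrow> 'a set \<Rightarrow> (nat \<Rightarrow> 'a set) \<Rightarrow> ennreal" where
  "C_plus R p I \<aa> =
     limsup (\<lambda>e. ennreal_of_enat (nu_filtration R I \<aa> (p ^ e)) / of_nat (p ^ e))"

definition C_minus ::
    "('a, 'b) ring_scheme \<Rightarrow> nat \<Rightarrow> 'a set \<Rightarrow> (nat \<Rightarrow> 'a set) \<Rightarrow> ennreal" where
  "C_minus R p I \<aa> =
     liminf (\<lambda>e. ennreal_of_enat (nu_filtration R I \<aa> (p ^ e)) / of_nat (p ^ e))"

end

theory Submission
  imports Defs
begin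

text \<open>
  The chains of inequalities are monotonicity of \<open>\<nu>\<close>. For the last one, \<open>J = I\<^sup>[\<^sup>q\<^sup>]\<close> is an ideal, so
  if the \<open>r\<close>-th term of the sum filtration is not contained in \<open>J\<close>, then some \<open>\<aa>\<^sub>i \<bb>\<^bsub>r - i\<^esub>\<close>
  is not, and hence neither \<open>\<aa>\<^sub>i\<close> nor \<open>\<bb>\<^bsub>r - i\<^esub>\<close> is. This gives
  \<open>r = i + (r - i) \<le> \<nu>(\<aa>) + \<nu>(\<bb>)\<close>, and the upper limit is subadditive.
\<close>

section \<open>Subadditivity of the upper limit in \<open>ennreal\<close>\<close>

lemma limsup_add_le_ennreal:
  fixes f g :: "nat \<Rightarrow> ennreal"
  shows "limsup (\<lambda>n. f n + g n) \<le> limsup f + limsup g"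
proof (rule LIMSEQ_le)
  let ?S = "\<lambda>h n. SUP m\<in>{n..}. h m :: ennreal"
  \<comment> \<open>The tail suprema decrease in \<open>n\<close>, so they converge to their
    infimum, which is the upper limit.\<close>
  have lim: "?S h \<longlonglongrightarrow> limsup h" for h :: "nat \<Rightarrow> ennreal"
    unfolding limsup_INF_SUP by (intro LIMSEQ_INF antimonoI SUP_subset_mono) auto
  show "?S (\<lambda>n. f n + g n) \<longlonglongrightarrow> limsup (\<lambda>n. f n + g n)"
    by (rule lim)
  show "(\<lambda>n. ?S f n + ?S g n) \<longlonglongrightarrow> limsup f + limsup g"
    \<comment> \<open>Addition is continuous on all of \<open>ennreal\<close>, so infinite values
      need no separate case.\<close>
    by (intro tendsto_add lim)
  show "\<exists>N. \<forall>n\<ge>N. ?S (\<lambda>n. f n + g n) n \<le> ?S f n + ?S g n"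
    by (intro exI allI impI SUP_least add_mono SUP_upper)
qed

section \<open>Inclusion of a product or a sum of ideals in an ideal\<close>

context ring
begin

text \<open>\<open>I \<cdot> J\<close> is built inductively from the products
  \<open>i \<otimes> j\<close> by addition, under which \<open>K\<close> is closed.\<close>

lemma ideal_prod_subset_iff:
  assumes "ideal K R"
  shows "I \<cdot> J \<subseteq> K \<longleftrightarrow> (\<forall>i\<in>I. \<forall>j\<in>J. i \<otimes> j \<in> K)"
proof (intro iffI subsetI)
  fix s assume "\<forall>i\<in>I. \<forall>j\<in>J. i \<otimes> j \<in> K" and "s \<in> I \<cdot> J"
  from this(2,1) show "s \<in> K"
    by induction (auto intro: additive_subgroup.a_closed ideal.axioms(1) assms)
qed (auto intro: ideal_prod.prod)

text \<open>The sum is the ideal generated by \<open>I \<union> J\<close>, hence the least ideal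
  containing both.\<close>

lemma set_add_ideals_subset_iff:
  assumes I: "ideal I R" and J: "ideal J R" and K: "ideal K R"
  shows "I <+> J \<subseteq> K \<longleftrightarrow> I \<subseteq> K \<and> J \<subseteq> K"
proof -
  have "I \<union> J \<subseteq> carrier R" "K \<subseteq> carrier R"
    using assms by (auto dest: ideal.Icarr)
  then show ?thesis
    using Idl_subset_ideal[OF K, of "I \<union> J"] union_genideal[OF I J] by auto
qed

end

section \<open>Colon ideals, finite sums of ideals, Frobenius powers\<close>

context cring
begin

lemma ideal_colon:
  assumes J: "ideal J R" and y: "y \<in> carrier R"
  shows "ideal {x \<in> carrier R. x \<otimes> y \<in> J} R"
proof -
  interpret J: ideal J R by (rule J)
  show ?thesis
  proof (rule idealI)
    show "subgroup {x \<in> carrier R. x \<otimes> y \<in> J} (add_monoid R)"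
      \<comment> \<open>\<open>\<zero>\<close> is the witness for nonemptiness, because
        \<open>\<zero> \<otimes> y = \<zero>\<close> lies in \<open>J\<close>.\<close>
      by (rule add.subgroupI)
        (use y J.zero_closed in \<open>auto simp: l_distr l_minus simp flip: a_inv_def intro!: exI[of _ \<zero>]\<close>)
  next
    fix a x assume a: "a \<in> {x \<in> carrier R. x \<otimes> y \<in> J}" and x: "x \<in> carrier R"
    then show "x \<otimes> a \<in> {x \<in> carrier R. x \<otimes> y \<in> J}"
      using y J.I_l_closed by (auto simp: m_assoc)
    then show "a \<otimes> x \<in> {x \<in> carrier R. x \<otimes> y \<in> J}"
      using a x m_comm by auto
  qed (rule ring_axioms)
qed

lemma finsum_ideals:
  assumes "finite A" and "\<And>i. i \<in> A \<Longrightarrow> ideal (f i) R"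
  shows "ideal (finsum (ideals_set R) f A) R"
    and "ideal K R \<Longrightarrow> finsum (ideals_set R) f A \<subseteq> K \<longleftrightarrow> (\<forall>i\<in>A. f i \<subseteq> K)"
proof -
  interpret S: semiring "ideals_set R" by (rule ideals_set_is_semiring)
  have car: "carrier (ideals_set R) = {I. ideal I R}" and add: "add (ideals_set R) = set_add R"
    and zero: "zero (ideals_set R) = {\<zero>}"
    by (simp_all add: ideals_set_def)
  \<comment> \<open>Both claims share one induction: the insertion step applies the criterion for
    \<open><+>\<close> to the partial sum, which must already be known to be an ideal.\<close>
  have "ideal (finsum (ideals_set R) f A) R \<and>
      (\<forall>K. ideal K R \<longrightarrow> (finsum (ideals_set R) f A \<subseteq> K \<longleftrightarrow> (\<forall>i\<in>A. f i \<subseteq> K)))"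
    using assms
  proof induction
    case empty
    then show ?case
      by (auto simp: zero zeroideal intro: additive_subgroup.zero_closed ideal.axioms(1))
  next
    case (insert a A)
    then show ?case
      by (simp add: S.finsum_insert car Pi_iff add add_ideals set_add_ideals_subset_iff)
  qed
  then show "ideal (finsum (ideals_set R) f A) R"
    and "ideal K R \<Longrightarrow> finsum (ideals_set R) f A \<subseteq> K \<longleftrightarrow> (\<forall>i\<in>A. f i \<subseteq> K)"
    by blast+
qed

lemma frobenius_power_ideal:
  assumes "ideal I R"
  shows "ideal (frobenius_power R I q) R"
  unfolding frobenius_power_def by (rule genideal_ideal) (use assms in \<open>auto dest: ideal.Icarr\<close>)

section \<open>Filtrations, with multiplicativity read on elements\<close>

lemma ideal_filtrationI:
  assumes "\<And>i. ideal (\<aa> i) R" and "\<aa> 0 = carrier R" and "\<And>i. \<aa> (Suc i) \<subseteq> \<aa> i"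
    and "\<And>i j x y. x \<in> \<aa> i \<Longrightarrow> y \<in> \<aa> j \<Longrightarrow> x \<otimes> y \<in> \<aa> (i + j)"
  shows "ideal_filtration R \<aa>"
  using assms by (auto simp: ideal_filtration_def ideal_prod_subset_iff)

lemma ideal_filtrationD:
  assumes "ideal_filtration R \<aa>"
  shows "ideal (\<aa> i) R" and "\<aa> 0 = carrier R" and "\<aa> (Suc i) \<subseteq> \<aa> i"
    and "x \<in> \<aa> i \<Longrightarrow> y \<in> \<aa> j \<Longrightarrow> x \<otimes> y \<in> \<aa> (i + j)"
proof -
  show "x \<otimes> y \<in> \<aa> (i + j)" if "x \<in> \<aa> i" "y \<in> \<aa> j"
    using assms ideal_prod.prod[OF that, of R] unfolding ideal_filtration_def by blast
qed (use assms in \<open>auto simp: ideal_filtration_def\<close>)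

section \<open>Intersection and product of two filtrations\<close>

lemma ideal_filtration_inter:
  assumes "ideal_filtration R \<aa>" and "ideal_filtration R \<bb>"
  shows "ideal_filtration R (filtration_inter \<aa> \<bb>)"
proof (rule ideal_filtrationI)
  note a = ideal_filtrationD[OF assms(1)] and b = ideal_filtrationD[OF assms(2)]
  show "ideal (filtration_inter \<aa> \<bb> i) R" for i
    unfolding filtration_inter_def by (intro i_intersect a(1) b(1))
  show "filtration_inter \<aa> \<bb> 0 = carrier R"
    by (simp add: filtration_inter_def a(2) b(2))
  show "filtration_inter \<aa> \<bb> (Suc i) \<subseteq> filtration_inter \<aa> \<bb> i" for i
    unfolding filtration_inter_def using a(3) b(3) by (rule Int_mono)
  show "x \<otimes> y \<in> filtration_inter \<aa> \<bb> (i + j)"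
    if "x \<in> filtration_inter \<aa> \<bb> i" "y \<in> filtration_inter \<aa> \<bb> j" for i j x y
    using that by (simp add: filtration_inter_def a(4) b(4))
qed

text \<open>Fixing one factor at a time, the elements whose product with it lies in \<open>K\<close> form a colon
  ideal, so the inclusion can be tested on generators.\<close>
lemma ideal_mult_closed_by_generators:
  assumes K: "ideal K R"
    and I: "ideal I R" "\<And>L. ideal L R \<Longrightarrow> I \<subseteq> L \<longleftrightarrow> S \<subseteq> L"
    and J: "ideal J R" "\<And>L. ideal L R \<Longrightarrow> J \<subseteq> L \<longleftrightarrow> T \<subseteq> L"
    and ST: "\<And>s t. s \<in> S \<Longrightarrow> t \<in> T \<Longrightarrow> s \<otimes> t \<in> K"
    and "x \<in> I" and "y \<in> J"
  shows "x \<otimes> y \<in> K"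
proof -
  \<comment> \<open>Taking the whole ring as \<open>L\<close> in both criteria places the generators
    in the carrier.\<close>
  have S: "S \<subseteq> carrier R" and T: "T \<subseteq> carrier R"
    using I(2)[OF oneideal] J(2)[OF oneideal] I(1) J(1) by (auto dest: ideal.Icarr)
  have xt: "x \<otimes> t \<in> K" if "t \<in> T" for t
  proof -
    have "t \<in> carrier R" using that T by blast
    note colon = I(2)[OF ideal_colon[OF K this]]
    have "S \<subseteq> {x \<in> carrier R. x \<otimes> t \<in> K}" using S ST that by auto
    with colon \<open>x \<in> I\<close> show ?thesis by auto
  qed
  have x: "x \<in> carrier R" using I(1) \<open>x \<in> I\<close> by (rule ideal.Icarr)
  \<comment> \<open>Now \<open>x\<close> is fixed and the second factor varies;
    \<open>ideal_colon\<close> multiplies on the right, hence the reversed order.\<close>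
  have "T \<subseteq> {y \<in> carrier R. y \<otimes> x \<in> K}"
  proof
    fix t assume "t \<in> T"
    with T have "t \<in> carrier R" by blast
    then show "t \<in> {y \<in> carrier R. y \<otimes> x \<in> K}"
      using xt[OF \<open>t \<in> T\<close>] x by (simp add: m_comm)
  qed
  with J(2)[OF ideal_colon[OF K x]] \<open>y \<in> J\<close> have "y \<in> carrier R" "y \<otimes> x \<in> K" by auto
  with x show ?thesis by (simp add: m_comm)
qed

text \<open>On generators, \<open>(u \<otimes> v) \<otimes> (w \<otimes> z) = (u \<otimes> w)
  \<otimes> (v \<otimes> z)\<close>, where \<open>u \<otimes> w\<close> lies in
  \<open>\<aa> (i + j)\<close> and \<open>v \<otimes> z\<close> in
  \<open>\<bb> (i + j)\<close>.\<close>

lemma ideal_filtration_prod: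
  assumes "ideal_filtration R \<aa>" and "ideal_filtration R \<bb>"
  shows "ideal_filtration R (filtration_prod R \<aa> \<bb>)"
proof -
  note a = ideal_filtrationD[OF assms(1)] and b = ideal_filtrationD[OF assms(2)]
  define S where "S n = {x \<otimes> y | x y. x \<in> \<aa> n \<and> y \<in> \<bb> n}" for n
  have id: "ideal (\<aa> n \<cdot> \<bb> n) R" for n by (intro ideal_prod_is_ideal a b)
  have S: "\<aa> n \<cdot> \<bb> n \<subseteq> L \<longleftrightarrow> S n \<subseteq> L" if "ideal L R" for n L
    using that by (auto simp: ideal_prod_subset_iff S_def)
  show ?thesis
    unfolding filtration_prod_def
  proof (rule ideal_filtrationI)
    show "\<aa> 0 \<cdot> \<bb> 0 = carrier R"
      using a(2) b(2) ideal_prod_one[OF oneideal] by simp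
    show "\<aa> (Suc i) \<cdot> \<bb> (Suc i) \<subseteq> \<aa> i \<cdot> \<bb> i" for i
      unfolding ideal_prod_subset_iff[OF id] using a(3)[of i] b(3)[of i]
      by (auto intro!: ideal_prod.prod)
    fix i j x y
    assume xy: "x \<in> \<aa> i \<cdot> \<bb> i" "y \<in> \<aa> j \<cdot> \<bb> j"
    show "x \<otimes> y \<in> \<aa> (i + j) \<cdot> \<bb> (i + j)"
    proof (rule ideal_mult_closed_by_generators[OF id id S id S _ xy])
      fix s t assume "s \<in> S i" "t \<in> S j"
      then obtain u v w z where *: "u \<in> \<aa> i" "v \<in> \<bb> i" "w \<in> \<aa> j" "z \<in> \<bb> j"
        and st: "s = u \<otimes> v" "t = w \<otimes> z" by (auto simp: S_def)
      have "u \<in> carrier R" "v \<in> carrier R" "w \<in> carrier R" "z \<in> carrier R"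
        using * a(1) b(1) ideal.Icarr by metis+
      then have "s \<otimes> t = (u \<otimes> w) \<otimes> (v \<otimes> z)" unfolding st by (simp add: m_ac)
      with * show "s \<otimes> t \<in> \<aa> (i + j) \<cdot> \<bb> (i + j)"
        by (simp add: ideal_prod.prod a(4) b(4))
    qed
  qed (rule id)
qed

section \<open>The sum filtration\<close>

lemma filtration_sum_ideal:
  assumes "ideal_filtration R \<aa>" and "ideal_filtration R \<bb>"
  shows "ideal (filtration_sum R \<aa> \<bb> n) R"
  unfolding filtration_sum_def
  by (intro finsum_ideals(1) finite_atLeastAtMost ideal_prod_is_ideal
      ideal_filtrationD(1)[OF assms(1)] ideal_filtrationD(1)[OF assms(2)])

text \<open>Used with the sum itself as \<open>K\<close> to place each summand in it, and with a
  Frobenius power as \<open>K\<close> to find a summand that escapes.\<close>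

lemma filtration_sum_subset_iff:
  assumes "ideal_filtration R \<aa>" and "ideal_filtration R \<bb>" and "ideal K R"
  shows "filtration_sum R \<aa> \<bb> n \<subseteq> K \<longleftrightarrow> (\<forall>i\<le>n. \<aa> i \<cdot> \<bb> (n - i) \<subseteq> K)"
  unfolding filtration_sum_def
  using finsum_ideals(2)[OF finite_atLeastAtMost, of 0 n "\<lambda>i. \<aa> i \<cdot> \<bb> (n - i)"] assms(3)
    ideal_prod_is_ideal ideal_filtrationD(1)[OF assms(1)] ideal_filtrationD(1)[OF assms(2)]
  by (simp add: Ball_def)

lemma mult_mem_filtration_sum:
  assumes "ideal_filtration R \<aa>" and "ideal_filtration R \<bb>" and "x \<in> \<aa> i" and "y \<in> \<bb> j"
  shows "x \<otimes> y \<in> filtration_sum R \<aa> \<bb> (i + j)"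
proof -
  \<comment> \<open>The sum is contained in itself, so each of its summands is; this one has index
    \<open>i\<close>.\<close>
  have "\<aa> i \<cdot> \<bb> (i + j - i) \<subseteq> filtration_sum R \<aa> \<bb> (i + j)"
    using filtration_sum_subset_iff[OF assms(1,2) filtration_sum_ideal[OF assms(1,2)], of "i + j" "i + j"]
    by (metis le_add1 order_refl)
  with ideal_prod.prod[OF assms(3,4), of R] show ?thesis by auto
qed

text \<open>\<open>\<aa> 0\<close> and \<open>\<bb> 0\<close> are the whole ring and contain
  \<open>\<one>\<close>, so the two extreme summands give \<open>x \<otimes> \<one>\<close> and
  \<open>\<one> \<otimes> y\<close>.\<close>

lemma subset_filtration_sum:
  assumes "ideal_filtration R \<aa>" and "ideal_filtration R \<bb>"
  shows "\<aa> n \<subseteq> filtration_sum R \<aa> \<bb> n" and "\<bb> n \<subseteq> filtration_sum R \<aa> \<bb> n"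
proof -
  note a = ideal_filtrationD[OF assms(1)] and b = ideal_filtrationD[OF assms(2)]
  show "\<aa> n \<subseteq> filtration_sum R \<aa> \<bb> n"
    using mult_mem_filtration_sum[OF assms, of _ n \<one> 0] b(2) ideal.Icarr[OF a(1)] by force
  show "\<bb> n \<subseteq> filtration_sum R \<aa> \<bb> n"
    using mult_mem_filtration_sum[OF assms, of \<one> 0 _ n] a(2) ideal.Icarr[OF b(1)] by force
qed

lemma ideal_filtration_sum:
  assumes "ideal_filtration R \<aa>" and "ideal_filtration R \<bb>"
  shows "ideal_filtration R (filtration_sum R \<aa> \<bb>)"
proof -
  note a = ideal_filtrationD[OF assms(1)] and b = ideal_filtrationD[OF assms(2)]
  let ?e = "filtration_sum R \<aa> \<bb>"
  define S where "S n = {x \<otimes> y | i x y. i \<le> n \<and> x \<in> \<aa> i \<and> y \<in> \<bb> (n - i)}" for n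
  note id = filtration_sum_ideal[OF assms]
  have S: "?e n \<subseteq> L \<longleftrightarrow> S n \<subseteq> L" if "ideal L R" for n L
    using that by (auto simp: filtration_sum_subset_iff[OF assms] ideal_prod_subset_iff S_def)
  show ?thesis
  proof (rule ideal_filtrationI)
    show "?e 0 = carrier R"
      using subset_filtration_sum(1)[OF assms, of 0] a(2) id[of 0] by (auto dest: ideal.Icarr)
  next
    fix n
    \<comment> \<open>One of the two indices must drop by one: that of \<open>\<bb>\<close> when
      \<open>i \<le> n\<close>, and that of \<open>\<aa>\<close> when \<open>i = Suc n\<close>,
      where the index of \<open>\<bb>\<close> is already 0.\<close>
    have "x \<otimes> y \<in> ?e n" if "i \<le> Suc n" "x \<in> \<aa> i" "y \<in> \<bb> (Suc n - i)" for i x y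
    proof (cases "i = Suc n")
      case True
      with that a(3) have "x \<in> \<aa> n" "y \<in> \<bb> 0" by auto
      then show ?thesis using mult_mem_filtration_sum[OF assms, of x n y 0] by simp
    next
      case False
      with that b(3)[of "n - i"] have "y \<in> \<bb> (n - i)" by (auto simp: Suc_diff_le)
      with that False show ?thesis
        using mult_mem_filtration_sum[OF assms, of x i y "n - i"] by simp
    qed
    then show "?e (Suc n) \<subseteq> ?e n" unfolding S[OF id] by (auto simp: S_def)
  next
    fix i j x y
    assume xy: "x \<in> ?e i" "y \<in> ?e j"
    show "x \<otimes> y \<in> ?e (i + j)"
    proof (rule ideal_mult_closed_by_generators[OF id id S id S _ xy])
      fix s t assume "s \<in> S i" "t \<in> S j"
      then obtain k l u v w z where kl: "k \<le> i" "l \<le> j"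
        and *: "u \<in> \<aa> k" "v \<in> \<bb> (i - k)" "w \<in> \<aa> l" "z \<in> \<bb> (j - l)"
        and st: "s = u \<otimes> v" "t = w \<otimes> z" by (auto simp: S_def)
      have "u \<in> carrier R" "v \<in> carrier R" "w \<in> carrier R" "z \<in> carrier R"
        using * a(1) b(1) ideal.Icarr by metis+
      then have "s \<otimes> t = (u \<otimes> w) \<otimes> (v \<otimes> z)" unfolding st by (simp add: m_ac)
      \<comment> \<open>The \<open>\<aa>\<close>-factors have total index \<open>k + l\<close> and
        the \<open>\<bb>\<close>-factors the rest; as \<open>k \<le> i\<close> and
        \<open>l \<le> j\<close>, the truncated differences are exact and the indices add up to
        \<open>i + j\<close>.\<close>
      also have "\<dots> \<in> ?e ((k + l) + ((i - k) + (j - l)))"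
        by (intro mult_mem_filtration_sum assms a(4) b(4) *)
      also have "(k + l) + ((i - k) + (j - l)) = i + j" using kl by simp
      finally show "s \<otimes> t \<in> ?e (i + j)" .
    qed
  qed (rule id)
qed

section \<open>Comparison of \<nu> and of its normalized limits\<close>

lemma nu_filtration_sum_le:
  assumes I: "ideal I R" and "ideal_filtration R \<aa>" and "ideal_filtration R \<bb>"
  shows "nu_filtration R I (filtration_sum R \<aa> \<bb>) q
    \<le> nu_filtration R I \<aa> q + nu_filtration R I \<bb> q"
  unfolding nu_filtration_def[of _ _ "filtration_sum R \<aa> \<bb>"]
\<comment> \<open>Bounding each \<open>r\<close> in the set suffices, also when the supremum is
  infinite.\<close>
proof (rule Sup_least)
  let ?J = "frobenius_power R I q"
  fix x assume "x \<in> {enat r | r. \<not> filtration_sum R \<aa> \<bb> r \<subseteq> ?J}"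
  then obtain r where x: "x = enat r" and "\<not> filtration_sum R \<aa> \<bb> r \<subseteq> ?J"
    by blast
  then obtain i where i: "i \<le> r" "\<not> \<aa> i \<cdot> \<bb> (r - i) \<subseteq> ?J"
    using filtration_sum_subset_iff[OF assms(2,3) frobenius_power_ideal[OF I]] by blast
  \<comment> \<open>A product of ideals lies in both factors, so a factor inside \<open>?J\<close>
    would force the product inside.\<close>
  have "\<not> \<aa> i \<subseteq> ?J" "\<not> \<bb> (r - i) \<subseteq> ?J"
    using i(2) ideal_prod_inter[of "\<aa> i" "\<bb> (r - i)"] assms(2,3) ideal_filtrationD(1) by blast+
  then have "enat i \<le> nu_filtration R I \<aa> q" "enat (r - i) \<le> nu_filtration R I \<bb> q"
    unfolding nu_filtration_def by (auto intro!: Sup_upper)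
  then have "enat i + enat (r - i) \<le> nu_filtration R I \<aa> q + nu_filtration R I \<bb> q"
    by (rule add_mono)
  with i(1) show "x \<le> nu_filtration R I \<aa> q + nu_filtration R I \<bb> q" by (simp add: x)
qed

end

text \<open>An index at which the smaller ideal escapes the Frobenius power is one for the larger
  ideal too, so the supremum is over a larger set.\<close>

lemma nu_filtration_mono:
  assumes "\<And>n. \<aa> n \<subseteq> \<bb> n"
  shows "nu_filtration R I \<aa> q \<le> nu_filtration R I \<bb> q"
  unfolding nu_filtration_def by (rule Sup_subset_mono) (use assms in blast)

lemma C_plus_mono:
  assumes "\<And>n. \<aa> n \<subseteq> \<bb> n"
  shows "C_plus R p I \<aa> \<le> C_plus R p I \<bb>"
  unfolding C_plus_def
  by (intro Limsup_mono always_eventually allI divide_right_mono_ennreal)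
    (simp add: nu_filtration_mono assms)

lemma C_minus_mono:
  assumes "\<And>n. \<aa> n \<subseteq> \<bb> n"
  shows "C_minus R p I \<aa> \<le> C_minus R p I \<bb>"
  unfolding C_minus_def
  by (intro Liminf_mono always_eventually allI divide_right_mono_ennreal)
    (simp add: nu_filtration_mono assms)

lemma (in cring) C_plus_filtration_sum_le:
  assumes "ideal I R" and "ideal_filtration R \<aa>" and "ideal_filtration R \<bb>"
  shows "C_plus R p I (filtration_sum R \<aa> \<bb>) \<le> C_plus R p I \<aa> + C_plus R p I \<bb>"
proof -
  let ?f = "\<lambda>\<cc> e. ennreal_of_enat (nu_filtration R I \<cc> (p ^ e)) / of_nat (p ^ e)"
  have "C_plus R p I (filtration_sum R \<aa> \<bb>) \<le> limsup (\<lambda>e. ?f \<aa> e + ?f \<bb> e)"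
    \<comment> \<open>The two fractions are merged into one with an \<open>enat\<close> sum in the
      numerator, so that the bound on \<nu> applies before division.\<close>
    unfolding C_plus_def add_divide_distrib_ennreal[symmetric] ennreal_of_enat_plus[symmetric]
    by (intro Limsup_mono always_eventually allI divide_right_mono_ennreal)
      (simp add: nu_filtration_sum_le assms del: ennreal_of_enat_plus)
  also have "\<dots> \<le> C_plus R p I \<aa> + C_plus R p I \<bb>"
    unfolding C_plus_def by (rule limsup_add_le_ennreal)
  finally show ?thesis .
qed

theorem proposition4p5:
  fixes R :: "('a, 'b) ring_scheme"
    and p :: nat
    and I :: "'a set"
    and \<aa> \<bb> :: "nat \<Rightarrow> 'a set"
  assumes "cring R" and "noetherian_ring R"
    and "prime p" and "ring_char R = p"
    and "ideal I R" and "I \<noteq> {\<zero>\<^bsub>R\<^esub>}" and "I \<noteq> carrier R"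
    and "ideal_filtration R \<aa>" and "ideal_filtration R \<bb>"
  shows "ideal_filtration R (filtration_prod R \<aa> \<bb>) \<and>
    ideal_filtration R (filtration_inter \<aa> \<bb>) \<and>
    ideal_filtration R (filtration_sum R \<aa> \<bb>) \<and>
    (\<forall>C \<in> {C_plus R p I, C_minus R p I}.
       C (filtration_prod R \<aa> \<bb>) \<le> C (filtration_inter \<aa> \<bb>) \<and>
       C (filtration_inter \<aa> \<bb>) \<le> C \<aa> \<and>
       C \<aa> \<le> C (filtration_sum R \<aa> \<bb>) \<and>
       C (filtration_inter \<aa> \<bb>) \<le> C \<bb> \<and>
       C \<bb> \<le> C (filtration_sum R \<aa> \<bb>)) \<and>
    C_plus R p I (filtration_sum R \<aa> \<bb>) \<le> C_plus R p I \<aa> + C_plus R p I \<bb>"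
proof -
  interpret cring R by fact
  note filtrations = \<open>ideal_filtration R \<aa>\<close> \<open>ideal_filtration R \<bb>\<close>
  have chain: "filtration_prod R \<aa> \<bb> n \<subseteq> filtration_inter \<aa> \<bb> n"
      "filtration_inter \<aa> \<bb> n \<subseteq> \<aa> n" "filtration_inter \<aa> \<bb> n \<subseteq> \<bb> n" for n
    unfolding filtration_prod_def filtration_inter_def
    by (intro ideal_prod_inter ideal_filtrationD(1) filtrations Int_lower1 Int_lower2)+
  \<comment> \<open>Both signs follow from monotonicity along the termwise inclusions; only the
    additive bound is special to the upper limit.\<close>
  show ?thesis
    by (simp add: filtrations \<open>ideal I R\<close> ideal_filtration_prod ideal_filtration_inter
        ideal_filtration_sum C_plus_filtration_sum_le C_plus_mono C_minus_mono chain
        subset_filtration_sum)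
qed

end
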